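(* For every $n$ there exists an edge-colored directed graph $G$ with $\Theta(n)$ vertices such that every $1$-color-fault-tolerant connectivity preserver $H\subseteq G$ of $G$ has $\tilde{\Omega}(n^2)$ edges (specifically $\Omega(n^2/\log n)$).
   Context: An edge-colored directed graph $G$ comes with a partition $\mathcal{C}$ of $E(G)$ into color classes. A subgraph $H$ of $G$ ($V(H)=V(G)$, $E(H)\subseteq E(G)$) is a $k$-color-fault-tolerant connectivity preserver if for every pair of vertices $u,v$ and every family $\mathcal{F}\subseteq\mathcal{C}$ of at most $k$ colors, $u,v$ are strongly connected in $G-\bigcup\mathcal{F}$ if and only if they are strongly connected in $H-\bigcup\mathcal{F}$, where $\bigcup\mathcal{F}$ is the union of the edge sets of the colors in $\mathcal{F}$. $\tilde\Omega$ hides polylogarithmic factors. *)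

theory Defs
  imports Complex_Main "HOL-Library.Disjoint_Sets" "Graph_Theory.Digraph_Component"
begin

definition edge_colored_digraph :: "('a, 'b) pre_digraph \<Rightarrow> 'b set set \<Rightarrow> bool" where
  "edge_colored_digraph G C \<longleftrightarrow> digraph G \<and> partition_on (arcs G) C"

definition del_arcs :: "('a, 'b) pre_digraph \<Rightarrow> 'b set \<Rightarrow> ('a, 'b) pre_digraph" where
  "del_arcs G A = \<lparr>verts = verts G, arcs = arcs G - A, tail = tail G, head = head G\<rparr>"

text \<open>The constant \<^const>\<open>strongly_connected\<close> speaks about a whole digraph; here two vertices are
  strongly connected if each one is reachable from the other.\<close>

definition strongly_connected_pair :: "('a, 'b) pre_digraph \<Rightarrow> 'a \<Rightarrow> 'a \<Rightarrow> bool" where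
  "strongly_connected_pair G u v \<longleftrightarrow> u \<rightarrow>\<^sup>*\<^bsub>G\<^esub> v \<and> v \<rightarrow>\<^sup>*\<^bsub>G\<^esub> u"

definition color_ft_preserver ::
  "nat \<Rightarrow> ('a, 'b) pre_digraph \<Rightarrow> 'b set set \<Rightarrow> ('a, 'b) pre_digraph \<Rightarrow> bool" where
  "color_ft_preserver k G C H \<longleftrightarrow>
     spanning H G \<and>
     (\<forall>u \<in> verts G. \<forall>v \<in> verts G. \<forall>F. F \<subseteq> C \<and> finite F \<and> card F \<le> k \<longrightarrow>
        (strongly_connected_pair (del_arcs G (\<Union>F)) u v \<longleftrightarrow>
         strongly_connected_pair (del_arcs H (\<Union>F)) u v))"

end

theory Submission
  imports Defs "HOL-Library.Sublist" "HOL-Library.Countable"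
begin

text \<open>
  For every colour \<open>i < 2 ^ k\<close> let \<open>w\<^sub>i\<close> be a word that lists all colours other than \<open>i\<close>, and take the
  trie of all prefixes of these words, the arc from \<open>w\<close> to \<open>w @ [c]\<close> having colour \<open>c\<close>. Once colour
  \<open>i\<close> fails, the only leaf that the root still reaches is \<open>w\<^sub>i\<close>. Join all leaves to all of \<open>n\<close> further
  vertices, and these back to the root: if colour \<open>i\<close> fails, the root can reach a further vertex
  \<open>y\<close> only through the arc from \<open>w\<^sub>i\<close> to \<open>y\<close>, so a preserver contains all \<open>2 ^ k * n\<close> of these arcs.
  The words are chosen by halving: the words of the colours in one half start with a list of the
  other half. The trie then has at most \<open>(k + 1) * 2 ^ k\<close> vertices, and we may take \<open>2 ^ k\<close>
  of order \<open>n / log n\<close>.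
\<close>

section \<open>Words that list all colours of a block except one\<close>

fun avoiding_word :: "nat \<Rightarrow> nat \<Rightarrow> nat \<Rightarrow> nat list" where
  "avoiding_word 0 a i = []"
| "avoiding_word (Suc k) a i =
     (if i < a + 2 ^ k then [a + 2 ^ k..<a + 2 ^ Suc k] @ avoiding_word k a i
      else [a..<a + 2 ^ k] @ avoiding_word k (a + 2 ^ k) i)"

lemma set_avoiding_word:
  "i \<in> {a..<a + 2 ^ k} \<Longrightarrow> set (avoiding_word k a i) = {a..<a + 2 ^ k} - {i}"
proof (induction k arbitrary: a)
  case (Suc k)
  define p :: nat where "p = 2 ^ k"
  have i: "a \<le> i" "i < a + p + p" and pow: "2 ^ Suc k = p + p"
    using Suc.prems by (auto simp: p_def)
  show ?case
  proof (cases "i < a + p")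
    case True
    then have "set (avoiding_word k a i) = {a..<a + p} - {i}"
      using Suc.IH[of a] i unfolding p_def by simp
    then have "set (avoiding_word (Suc k) a i) = {a + p..<a + (p + p)} \<union> ({a..<a + p} - {i})"
      using True by (simp add: p_def mult_2)
    also have "\<dots> = {a..<a + (p + p)} - {i}" using True by auto
    finally show ?thesis unfolding pow .
  next
    case False
    then have "set (avoiding_word k (a + p) i) = {a + p..<a + p + p} - {i}"
      using Suc.IH[of "a + p"] i unfolding p_def by simp
    then have "set (avoiding_word (Suc k) a i) = {a..<a + p} \<union> ({a + p..<a + p + p} - {i})"
      using False by (simp add: p_def)
    also have "\<dots> = {a..<a + (p + p)} - {i}" using False by auto
    finally show ?thesis unfolding pow .
  qed
qed auto

text \<open>A word determines its colour, as the only colour of the block that it misses. Different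
  colours therefore lead to different leaves, which the count of leaf arcs relies on.\<close>

lemma inj_on_avoiding_word: "inj_on (avoiding_word k a) {a..<a + 2 ^ k}"
proof (rule inj_onI)
  fix i j
  assume i: "i \<in> {a..<a + 2 ^ k}" and j: "j \<in> {a..<a + 2 ^ k}"
    and "avoiding_word k a i = avoiding_word k a j"
  then have "{a..<a + 2 ^ k} - {i} = {a..<a + 2 ^ k} - {j}"
    by (simp only: set_avoiding_word[OF i, symmetric] set_avoiding_word[OF j, symmetric])
  with i j show "i = j" by blast
qed

section \<open>The trie of prefixes and its size\<close>

definition word_trie :: "nat \<Rightarrow> nat \<Rightarrow> nat list set" where
  "word_trie k a = {w. \<exists>i \<in> {a..<a + 2 ^ k}. prefix w (avoiding_word k a i)}"

lemma prefix_word_trie: "prefix v w \<Longrightarrow> w \<in> word_trie k a \<Longrightarrow> v \<in> word_trie k a"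
  unfolding word_trie_def by (blast intro: prefix_order.trans)

lemma Nil_in_word_trie: "[] \<in> word_trie k a"
  unfolding word_trie_def by (auto intro!: bexI[of _ a])

lemma avoiding_word_in_word_trie: "i \<in> {a..<a + 2 ^ k} \<Longrightarrow> avoiding_word k a i \<in> word_trie k a"
  unfolding word_trie_def by auto

text \<open>Proper prefixes of \<open>u\<close> are indexed by their length, so that they can be
  counted by \<open>length u\<close>; the word \<open>u\<close> itself falls into the second case,
  with \<open>v' = []\<close>.\<close>

lemma prefix_append_cases:
  assumes "prefix w (u @ v)"
  shows "w \<in> (\<lambda>m. take m u) ` {..<length u} \<or> (\<exists>v'. prefix v' v \<and> w = u @ v')"
proof (cases "length w < length u")
  case True
  with assms have "w = take (length w) u"
    by (metis append_eq_conv_conj prefix_def take_append diff_is_0_eq less_imp_le take0 append_Nil2)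
  with True show ?thesis by blast
next
  case False
  from assms obtain z where "w @ z = u @ v" by (metis prefix_def)
  with False show ?thesis by (auto simp: append_eq_append_conv2)
qed

text \<open>All words for colours in one half begin with the same list of the other half. Each half
  thus contributes a single path of \<open>2 ^ k\<close> proper prefixes with one smaller trie
  hanging at its end.\<close>

lemma word_trie_Suc_subset:
  "word_trie (Suc k) a \<subseteq>
     (\<lambda>m. take m [a + 2 ^ k..<a + 2 ^ Suc k]) ` {..<2 ^ k}
     \<union> (@) [a + 2 ^ k..<a + 2 ^ Suc k] ` word_trie k a
     \<union> ((\<lambda>m. take m [a..<a + 2 ^ k]) ` {..<2 ^ k}
     \<union> (@) [a..<a + 2 ^ k] ` word_trie k (a + 2 ^ k))"
proof
  fix w assume "w \<in> word_trie (Suc k) a"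
  then obtain i where i: "a \<le> i" "i < a + 2 ^ Suc k" "prefix w (avoiding_word (Suc k) a i)"
    unfolding word_trie_def by auto
  show "w \<in> (\<lambda>m. take m [a + 2 ^ k..<a + 2 ^ Suc k]) ` {..<2 ^ k}
     \<union> (@) [a + 2 ^ k..<a + 2 ^ Suc k] ` word_trie k a
     \<union> ((\<lambda>m. take m [a..<a + 2 ^ k]) ` {..<2 ^ k}
     \<union> (@) [a..<a + 2 ^ k] ` word_trie k (a + 2 ^ k))"
  proof (cases "i < a + 2 ^ k")
    case True
    with i have "prefix w ([a + 2 ^ k..<a + 2 ^ Suc k] @ avoiding_word k a i)" by simp
    moreover have "v \<in> word_trie k a" if "prefix v (avoiding_word k a i)" for v
      using that True i(1) unfolding word_trie_def by auto
    moreover have "length [a + 2 ^ k..<a + 2 ^ Suc k] = 2 ^ k" by simp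
    ultimately show ?thesis
      using prefix_append_cases[of w "[a + 2 ^ k..<a + 2 ^ Suc k]" "avoiding_word k a i"] by auto
  next
    case False
    with i have "prefix w ([a..<a + 2 ^ k] @ avoiding_word k (a + 2 ^ k) i)" by simp
    moreover have "v \<in> word_trie k (a + 2 ^ k)" if "prefix v (avoiding_word k (a + 2 ^ k) i)" for v
      using that False i(2) unfolding word_trie_def by auto
    moreover have "length [a..<a + 2 ^ k] = 2 ^ k" by simp
    ultimately show ?thesis
      using prefix_append_cases[of w "[a..<a + 2 ^ k]" "avoiding_word k (a + 2 ^ k) i"] by auto
  qed
qed

text \<open>The two branches give the recurrence T(k + 1) \<le> 2 (2^k + T(k)) with T(0) = 1, which
  (k + 1) 2^k satisfies with equality.\<close>

lemma finite_card_word_trie: "finite (word_trie k a) \<and> card (word_trie k a) \<le> (k + 1) * 2 ^ k"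
proof (induction k arbitrary: a)
  case 0
  have "word_trie 0 a = {[]}" unfolding word_trie_def by auto
  then show ?case by simp
next
  case (Suc k)
  \<comment> \<open>One estimate serves both branches: \<open>u\<close> is the shared list that
    starts the branch, \<open>b\<close> the first colour of the smaller trie below it.\<close>
  have bound: "finite ((\<lambda>m. take m u) ` {..<2 ^ k} \<union> (@) u ` word_trie k b) \<and>
      card ((\<lambda>m. take m u) ` {..<2 ^ k} \<union> (@) u ` word_trie k b) \<le> 2 ^ k + (k + 1) * 2 ^ k"
    for u :: "nat list" and b
  proof
    show "finite ((\<lambda>m. take m u) ` {..<2 ^ k} \<union> (@) u ` word_trie k b)"
      using Suc by simp
    have "card ((\<lambda>m. take m u) ` {..<2 ^ k :: nat}) \<le> 2 ^ k"
      using card_image_le[of "{..<2 ^ k :: nat}" "\<lambda>m. take m u"] by simp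
    moreover have "card ((@) u ` word_trie k b) \<le> (k + 1) * 2 ^ k"
      using Suc[of b] card_image_le[of "word_trie k b" "(@) u"] by linarith
    ultimately show "card ((\<lambda>m. take m u) ` {..<2 ^ k} \<union> (@) u ` word_trie k b)
        \<le> 2 ^ k + (k + 1) * 2 ^ k"
      by (meson add_mono card_Un_le le_trans)
  qed
  let ?A = "(\<lambda>m. take m [a + 2 ^ k..<a + 2 ^ Suc k]) ` {..<2 ^ k}
     \<union> (@) [a + 2 ^ k..<a + 2 ^ Suc k] ` word_trie k a"
  let ?B = "(\<lambda>m. take m [a..<a + 2 ^ k]) ` {..<2 ^ k}
     \<union> (@) [a..<a + 2 ^ k] ` word_trie k (a + 2 ^ k)"
  have fin: "finite (?A \<union> ?B)" using bound by blast
  have sub: "word_trie (Suc k) a \<subseteq> ?A \<union> ?B" by (rule word_trie_Suc_subset)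
  have "card (word_trie (Suc k) a) \<le> card (?A \<union> ?B)"
    by (rule card_mono[OF fin sub])
  also have "\<dots> \<le> card ?A + card ?B" by (rule card_Un_le)
  also have "\<dots> \<le> (2 ^ k + (k + 1) * 2 ^ k) + (2 ^ k + (k + 1) * 2 ^ k)"
    by (intro add_mono bound[THEN conjunct2])
  also have "\<dots> = (Suc k + 1) * 2 ^ Suc k" by (simp add: algebra_simps)
  finally show ?case using finite_subset[OF sub fin] by blast
qed

section \<open>The coloured digraph\<close>

definition trie_vertex :: "nat list \<Rightarrow> nat" where
  "trie_vertex w = 2 * to_nat w"

text \<open>Odd numbers, whereas trie vertices are even: the two kinds stay disjoint inside the
  vertex type \<open>nat\<close>.\<close>

definition outer_vertex :: "nat \<Rightarrow> nat" where
  "outer_vertex j = 2 * j + 1"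

lemma trie_vertex_eq_iff [simp]: "trie_vertex v = trie_vertex w \<longleftrightarrow> v = w"
  by (simp add: trie_vertex_def)

lemma from_nat_trie_vertex [simp]: "from_nat (trie_vertex w div 2) = w"
  by (simp add: trie_vertex_def)

lemma outer_vertex_eq_iff [simp]: "outer_vertex i = outer_vertex j \<longleftrightarrow> i = j"
  by (simp add: outer_vertex_def)

lemma trie_vertex_neq_outer_vertex [simp]:
  "trie_vertex w \<noteq> outer_vertex j" "outer_vertex j \<noteq> trie_vertex w"
  unfolding trie_vertex_def outer_vertex_def by presburger+

text \<open>The complete bipartite graph from leaves to outer vertices; these are the arcs that
  every preserver will be forced to keep.\<close>

definition leaf_arcs :: "nat \<Rightarrow> nat \<Rightarrow> (nat \<times> nat) set" where
  "leaf_arcs k n =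
     (\<lambda>(i, j). (trie_vertex (avoiding_word k 0 i), outer_vertex j)) ` ({0..<2 ^ k} \<times> {..<n})"

definition trie_digraph :: "nat \<Rightarrow> nat \<Rightarrow> (nat, nat \<times> nat) pre_digraph" where
  "trie_digraph k n =
     \<lparr>verts = trie_vertex ` word_trie k 0 \<union> outer_vertex ` {..<n},
      arcs = {(trie_vertex w, trie_vertex (w @ [c])) | w c. w @ [c] \<in> word_trie k 0}
        \<union> (\<lambda>j. (outer_vertex j, trie_vertex [])) ` {..<n} \<union> leaf_arcs k n,
      tail = fst, head = snd\<rparr>"

text \<open>The head of a trie arc decodes to \<open>w @ [c]\<close>, so its last letter is the
  colour. Leaf arcs and return arcs share the extra colour \<open>None\<close> and hence survive the
  failure of any \<open>Some i\<close>.\<close>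

definition arc_color :: "nat \<times> nat \<Rightarrow> nat option" where
  "arc_color e = (if \<exists>w c. e = (trie_vertex w, trie_vertex (w @ [c]))
     then Some (last (from_nat (snd e div 2))) else None)"

lemma arc_color_simps [simp]:
  "arc_color (trie_vertex w, trie_vertex (w @ [c])) = Some c"
  "arc_color (outer_vertex j, u) = None"
  "arc_color (u, outer_vertex j) = None"
  unfolding arc_color_def by auto

text \<open>Only attained values index the classes, because a partition has no empty class.\<close>

definition fibers :: "('e \<Rightarrow> 'c) \<Rightarrow> 'e set \<Rightarrow> 'e set set" where
  "fibers f A = (\<lambda>c. {e \<in> A. f e = c}) ` f ` A"

lemma partition_on_fibers: "partition_on A (fibers f A)"
  by (rule partition_onI) (auto simp: fibers_def disjnt_iff)

text \<open>Deleting the arcs of any given value counts as a failure of at most one colour. A value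
  that is not attained corresponds to the empty family; this occurs for \<open>k = 0\<close>, where
  the trie has no arcs.\<close>

lemma fiber_as_Union:
  obtains F where "F \<subseteq> fibers f A" "finite F" "card F \<le> 1" "\<Union>F = {e \<in> A. f e = c}"
proof (cases "c \<in> f ` A")
  case True
  then show ?thesis using that[of "{{e \<in> A. f e = c}}"] by (auto simp: fibers_def)
next
  case False
  then show ?thesis using that[of "{}"] by auto
qed

lemma arcs_trie_digraph_cases:
  assumes "e \<in> arcs (trie_digraph k n)"
  obtains (trie) w c where "w @ [c] \<in> word_trie k 0" "e = (trie_vertex w, trie_vertex (w @ [c]))"
  | (return) j where "j < n" "e = (outer_vertex j, trie_vertex [])"
  | (leaf) i j where "i \<in> {0..<2 ^ k}" "j < n"
      "e = (trie_vertex (avoiding_word k 0 i), outer_vertex j)"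
  using assms by (auto simp: trie_digraph_def leaf_arcs_def)

lemma arcs_trie_digraph_subset:
  "arcs (trie_digraph k n) \<subseteq> verts (trie_digraph k n) \<times> verts (trie_digraph k n)"
proof
  fix e assume "e \<in> arcs (trie_digraph k n)"
  then show "e \<in> verts (trie_digraph k n) \<times> verts (trie_digraph k n)"
  proof (cases rule: arcs_trie_digraph_cases)
    case (trie w c)
    then have "w \<in> word_trie k 0" using prefix_word_trie[of w "w @ [c]"] by simp
    with trie show ?thesis by (simp add: trie_digraph_def)
  next
    case return
    then show ?thesis using Nil_in_word_trie by (simp add: trie_digraph_def)
  next
    case leaf
    then show ?thesis using avoiding_word_in_word_trie[of _ 0 k] by (simp add: trie_digraph_def)
  qed
qed

lemma digraph_trie_digraph: "digraph (trie_digraph k n)"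
proof
  fix e assume e: "e \<in> arcs (trie_digraph k n)"
  have ends: "tail (trie_digraph k n) = fst" "head (trie_digraph k n) = snd"
    by (simp_all add: trie_digraph_def)
  show "tail (trie_digraph k n) e \<in> verts (trie_digraph k n)"
    and "head (trie_digraph k n) e \<in> verts (trie_digraph k n)"
    using subsetD[OF arcs_trie_digraph_subset e] ends by (simp_all add: mem_Times_iff)
  from e show "tail (trie_digraph k n) e \<noteq> head (trie_digraph k n) e"
    by (cases rule: arcs_trie_digraph_cases) (simp_all add: ends)
next
  show fin: "finite (verts (trie_digraph k n))"
    using finite_card_word_trie by (simp add: trie_digraph_def)
  show "finite (arcs (trie_digraph k n))"
    by (rule finite_subset[OF arcs_trie_digraph_subset]) (use fin in simp)
\<comment> \<open>An arc is the pair of its ends, so there are no parallel arcs.\<close>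
qed (auto simp: trie_digraph_def arc_to_ends_def)

lemma card_leaf_arcs: "card (leaf_arcs k n) = 2 ^ k * n"
proof -
  have "inj_on (\<lambda>(i, j). (trie_vertex (avoiding_word k 0 i), outer_vertex j))
      ({0..<2 ^ k} \<times> {..<n})"
    using inj_on_avoiding_word[of k 0] by (auto simp: inj_on_def)
  then show ?thesis by (simp add: leaf_arcs_def card_image)
qed

lemma card_verts_trie_digraph:
  "n \<le> card (verts (trie_digraph k n))" "card (verts (trie_digraph k n)) \<le> (k + 1) * 2 ^ k + n"
proof -
  have outer: "card (outer_vertex ` {..<n}) = n"
    by (simp add: card_image inj_on_def)
  have fin: "finite (verts (trie_digraph k n))"
    using finite_card_word_trie by (simp add: trie_digraph_def)
  have "card (outer_vertex ` {..<n}) \<le> card (verts (trie_digraph k n))"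
    by (rule card_mono[OF fin]) (simp add: trie_digraph_def)
  with outer show "n \<le> card (verts (trie_digraph k n))" by simp
  have "card (trie_vertex ` word_trie k 0) \<le> (k + 1) * 2 ^ k"
    using finite_card_word_trie card_image_le le_trans by blast
  then show "card (verts (trie_digraph k n)) \<le> (k + 1) * 2 ^ k + n"
    using outer card_Un_le[of "trie_vertex ` word_trie k 0" "outer_vertex ` {..<n}"]
    by (simp add: trie_digraph_def)
qed

section \<open>Reachability after the failure of a colour\<close>

lemma reachable_closed:
  assumes "u \<rightarrow>\<^sup>*\<^bsub>G\<^esub> v" "u \<in> S"
    and "\<And>e. e \<in> arcs G \<Longrightarrow> tail G e \<in> S \<Longrightarrow> head G e \<in> S"
  shows "v \<in> S"
  using assms(1) unfolding reachable_def
proof (induction rule: rtrancl_on_induct)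
  case (step y z)
  then obtain e where "e \<in> arcs G" "tail G e = y" "head G e = z"
    unfolding arcs_ends_def arc_to_ends_def by auto
  with step assms(3) show ?case by blast
qed (rule assms(2))

text \<open>The word of \<open>i\<close> never uses the letter \<open>i\<close>, so the trie path
  spelling it survives. It is followed by a leaf arc, and the return arc closes the cycle.\<close>

lemma strongly_connected_outer_vertex:
  assumes i: "i \<in> {0..<2 ^ k}" and j: "j < n"
  shows "strongly_connected_pair
    (del_arcs (trie_digraph k n) {e \<in> arcs (trie_digraph k n). arc_color e = Some i})
    (trie_vertex []) (outer_vertex j)"
    (is "strongly_connected_pair ?D _ _")
proof -
  interpret G: digraph "trie_digraph k n" by (rule digraph_trie_digraph)
  interpret D: wf_digraph ?D
    by unfold_locales (auto simp: del_arcs_def)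
  have arcI: "u \<rightarrow>\<^bsub>?D\<^esub> v" if "(u, v) \<in> arcs (trie_digraph k n)" "arc_color (u, v) \<noteq> Some i" for u v
    using that by (force simp: arcs_ends_def arc_to_ends_def del_arcs_def trie_digraph_def)
  have "trie_vertex [] \<rightarrow>\<^sup>*\<^bsub>?D\<^esub> trie_vertex w" if "prefix w (avoiding_word k 0 i)" for w
    using that
  proof (induction w rule: rev_induct)
    case Nil
    have "trie_vertex [] \<in> verts ?D"
      using Nil_in_word_trie by (auto simp: del_arcs_def trie_digraph_def)
    then show ?case by (rule D.reachable_refl)
  next
    case (snoc c w)
    then have "c \<in> set (avoiding_word k 0 i)"
      using set_mono_prefix by fastforce
    then have "c \<noteq> i" using set_avoiding_word[of i 0 k] i by simp
    moreover have "w @ [c] \<in> word_trie k 0"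
      using snoc.prems avoiding_word_in_word_trie[of i 0 k] i prefix_word_trie by simp
    ultimately have "trie_vertex w \<rightarrow>\<^bsub>?D\<^esub> trie_vertex (w @ [c])"
      by (intro arcI) (auto simp: trie_digraph_def)
    moreover have "trie_vertex [] \<rightarrow>\<^sup>*\<^bsub>?D\<^esub> trie_vertex w"
      using snoc by (meson append_prefixD)
    ultimately show ?case by (rule D.reachable_adj_trans[rotated])
  qed
  then have "trie_vertex [] \<rightarrow>\<^sup>*\<^bsub>?D\<^esub> trie_vertex (avoiding_word k 0 i)" by simp
  moreover have "trie_vertex (avoiding_word k 0 i) \<rightarrow>\<^bsub>?D\<^esub> outer_vertex j"
    using i j by (intro arcI) (auto simp: trie_digraph_def leaf_arcs_def)
  ultimately have "trie_vertex [] \<rightarrow>\<^sup>*\<^bsub>?D\<^esub> outer_vertex j"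
    by (rule D.reachable_adj_trans)
  moreover have "outer_vertex j \<rightarrow>\<^sup>*\<^bsub>?D\<^esub> trie_vertex []"
    using j by (intro D.reachable_adjI arcI) (auto simp: trie_digraph_def)
  ultimately show ?thesis by (simp add: strongly_connected_pair_def)
qed

lemma not_reachable_without_leaf_arc:
  assumes i: "i \<in> {0..<2 ^ k}" and sub: "subgraph H (trie_digraph k n)"
    and notin: "(trie_vertex (avoiding_word k 0 i), outer_vertex j) \<notin> arcs H"
  shows "\<not> trie_vertex [] \<rightarrow>\<^sup>*\<^bsub>del_arcs H {e \<in> arcs (trie_digraph k n). arc_color e = Some i}\<^esub>
    outer_vertex j"
    (is "\<not> _ \<rightarrow>\<^sup>*\<^bsub>?D\<^esub> _")
proof
  \<comment> \<open>This set traps every walk from the root: a trie arc leaves it only by appending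
    \<open>i\<close>, and such arcs are deleted; return arcs lead to the root; and the only leaf
    inside is the word of \<open>i\<close>, whose arc to \<open>j\<close> is missing from
    \<open>H\<close>.\<close>
  let ?S = "trie_vertex ` {w. i \<notin> set w} \<union> outer_vertex ` (UNIV - {j})"
  assume "trie_vertex [] \<rightarrow>\<^sup>*\<^bsub>?D\<^esub> outer_vertex j"
  moreover have "trie_vertex [] \<in> ?S" by simp
  moreover have "head ?D e \<in> ?S" if e: "e \<in> arcs ?D" and t: "tail ?D e \<in> ?S" for e
  proof -
    have ends: "tail ?D = fst" "head ?D = snd"
      using sub by (auto simp: subgraph_def compatible_def del_arcs_def trie_digraph_def)
    have eH: "e \<in> arcs H" and eG: "e \<in> arcs (trie_digraph k n)" and col: "arc_color e \<noteq> Some i"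
      using e sub by (auto simp: subgraph_def del_arcs_def)
    from eG show ?thesis
    proof (cases rule: arcs_trie_digraph_cases)
      case trie
      then show ?thesis using t col by (auto simp: ends)
    next
      case return
      then show ?thesis by (simp add: ends)
    next
      case (leaf i' l)
      then have "i \<notin> set (avoiding_word k 0 i')" using t by (auto simp: ends)
      \<comment> \<open>The word of \<open>i'\<close> contains every colour other than
        \<open>i'\<close>, so it can miss \<open>i\<close> only if the two agree.\<close>
      then have "i' = i" using set_avoiding_word[of i' 0 k] leaf(1) i by auto
      then have "l \<noteq> j" using leaf(3) notin eH by auto
      then show ?thesis using leaf(3) by (simp add: ends)
    qed
  qed
  ultimately have "outer_vertex j \<in> ?S" by (rule reachable_closed)
  then show False by auto
qed

text \<open>For the leaf arc given by \<open>i\<close> and \<open>j\<close>, let colour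
  \<open>i\<close> fail and compare the root with outer vertex \<open>j\<close>: they are strongly
  connected in the digraph, hence also in \<open>H\<close>, which is impossible without that
  arc.\<close>

lemma leaf_arcs_subset_preserver:
  assumes "color_ft_preserver 1 (trie_digraph k n) (fibers arc_color (arcs (trie_digraph k n))) H"
  shows "leaf_arcs k n \<subseteq> arcs H"
proof
  fix e assume "e \<in> leaf_arcs k n"
  then obtain i j where i: "i \<in> {0..<2 ^ k}" and j: "j < n"
    and e: "e = (trie_vertex (avoiding_word k 0 i), outer_vertex j)"
    unfolding leaf_arcs_def by auto
  let ?F = "{e \<in> arcs (trie_digraph k n). arc_color e = Some i}"
  obtain F where F: "F \<subseteq> fibers arc_color (arcs (trie_digraph k n))" "finite F" "card F \<le> 1"
    "\<Union>F = ?F"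
    by (rule fiber_as_Union)
  have verts: "trie_vertex [] \<in> verts (trie_digraph k n)" "outer_vertex j \<in> verts (trie_digraph k n)"
    using Nil_in_word_trie j by (auto simp: trie_digraph_def)
  have "strongly_connected_pair (del_arcs (trie_digraph k n) (\<Union>F)) (trie_vertex []) (outer_vertex j)
    \<longleftrightarrow> strongly_connected_pair (del_arcs H (\<Union>F)) (trie_vertex []) (outer_vertex j)"
    using assms verts F(1-3) unfolding color_ft_preserver_def by blast
  then have "strongly_connected_pair (del_arcs H ?F) (trie_vertex []) (outer_vertex j)"
    using strongly_connected_outer_vertex[OF i j] unfolding F(4) by blast
  then have "trie_vertex [] \<rightarrow>\<^sup>*\<^bsub>del_arcs H ?F\<^esub> outer_vertex j"
    by (simp add: strongly_connected_pair_def)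
  moreover have "subgraph H (trie_digraph k n)"
    using assms by (simp add: color_ft_preserver_def spanning_def)
  ultimately show "e \<in> arcs H"
    using not_reachable_without_leaf_arc[OF i] e by blast
qed

lemma card_preserver_trie_digraph:
  assumes "color_ft_preserver 1 (trie_digraph k n) (fibers arc_color (arcs (trie_digraph k n))) H"
  shows "2 ^ k * n \<le> card (arcs H)"
proof -
  interpret G: digraph "trie_digraph k n" by (rule digraph_trie_digraph)
  have "finite (arcs H)"
    using assms by (auto intro!: finite_subset[OF _ G.finite_arcs]
        simp: color_ft_preserver_def spanning_def subgraph_def)
  then show ?thesis
    using card_mono leaf_arcs_subset_preserver[OF assms] card_leaf_arcs by metis
qed

section \<open>Choice of the depth and the final estimate\<close>

lemma obtain_halving_depth:
  assumes "n \<ge> 1"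
  obtains k :: nat where "k * 2 ^ k \<le> n" "n < (k + 1) * 2 ^ (k + 1)" "2 ^ k \<le> n"
proof -
  \<comment> \<open>Bounds the candidates, so that a greatest one exists.\<close>
  have le: "k \<le> n" if "k * 2 ^ k \<le> n" for k :: nat
    using that by (metis le_trans mult.right_neutral mult_le_mono2 one_le_numeral one_le_power)
  \<comment> \<open>The largest depth whose trie still has size O(n); maximality makes
    \<open>2 ^ k\<close> of order at least n / log n.\<close>
  define k where "k = (GREATEST k. k * 2 ^ k \<le> n)"
  have k: "k * 2 ^ k \<le> n"
    unfolding k_def by (rule GreatestI_nat[of _ 0 n]) (auto intro: le)
  have "\<not> (k + 1) * 2 ^ (k + 1) \<le> n"
  proof
    assume "(k + 1) * 2 ^ (k + 1) \<le> n"
    then have "k + 1 \<le> k"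
      unfolding k_def by (intro Greatest_le_nat[of _ _ n]) (auto intro: le)
    then show False by simp
  qed
  moreover have "2 ^ k \<le> n"
    using k assms by (cases k) auto
  ultimately show ?thesis using that k by simp
qed

text \<open>From \<open>2 ^ k \<le> n\<close> follows k + 1 \<le> 4 ln n, so the upper bound on n
  gives n \<le> 8 ln n * 2^k; multiplying by n yields the factor 1/8.\<close>

lemma halving_depth_bound:
  fixes k n :: nat
  assumes n: "n \<ge> 2" and upper: "n < (k + 1) * 2 ^ (k + 1)" and lower: "2 ^ k \<le> n"
  shows "1 / 8 * (real n ^ 2 / ln (real n)) \<le> real (2 ^ k * n)"
proof -
  have ln_pos: "ln (real n) > 0" using n by simp
  \<comment> \<open>This is ln x \<le> x - 1 at x = 1/2.\<close>
  have ln2: "1 / 2 \<le> ln (2::real)" using ln_le_minus_one[of "1 / 2 :: real"] by (simp add: ln_div)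
  have ln2n: "ln 2 \<le> ln (real n)" using n by simp
  have "real k * ln 2 = ln (2 ^ k)" by (simp add: ln_realpow)
  also have "\<dots> \<le> ln (real n)"
    using lower n by (metis ln_mono numeral_power_le_of_nat_cancel_iff of_nat_numeral
        of_nat_power zero_less_numeral zero_less_power)
  \<comment> \<open>The summand 1 costs one more ln n, since ln 2 \<le> ln n for n \<ge> 2.\<close>
  finally have "(real k + 1) * ln 2 \<le> 2 * ln (real n)"
    using ln2n by (simp add: algebra_simps)
  moreover have "(real k + 1) * (1 / 2) \<le> (real k + 1) * ln 2"
    using ln2 by (intro mult_left_mono) auto
  ultimately have "(real k + 1) * (1 / 2) \<le> 2 * ln (real n)" by (rule order_trans[rotated])
  then have k1: "real k + 1 \<le> 4 * ln (real n)" by simp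
  have "real n \<le> real ((k + 1) * 2 ^ (k + 1))" using upper by (simp only: of_nat_le_iff less_imp_le)
  also have "\<dots> = (real k + 1) * (2 * 2 ^ k)" by (simp add: algebra_simps)
  also have "\<dots> \<le> 4 * ln (real n) * (2 * 2 ^ k)"
    using k1 by (intro mult_right_mono) auto
  finally have "real n * real n \<le> 4 * ln (real n) * (2 * 2 ^ k) * real n"
    by (intro mult_right_mono) auto
  then show ?thesis using ln_pos by (simp add: field_simps power2_eq_square)
qed

lemma color_ft_preserver_lower_bound:
  fixes n :: nat
  shows "\<exists>(G :: (nat, nat \<times> nat) pre_digraph) C.
    edge_colored_digraph G C \<and>
    1 * real n \<le> real (card (verts G)) \<and> real (card (verts G)) \<le> 3 * real n \<and>
    (\<forall>H. color_ft_preserver 1 G C H \<longrightarrow>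
       real (card (arcs H)) \<ge> 1 / 8 * (real n ^ 2 / ln (real n)))"
proof (cases "n = 0")
  case True
  \<comment> \<open>For n = 0 the upper bound on the number of vertices forces the empty
    digraph.\<close>
  let ?G = "\<lparr>verts = {}, arcs = {}, tail = fst, head = snd\<rparr> :: (nat, nat \<times> nat) pre_digraph"
  have "digraph ?G" by unfold_locales auto
  then have "edge_colored_digraph ?G {}"
    by (simp add: edge_colored_digraph_def partition_on_empty)
  with True show ?thesis by (intro exI[of _ ?G] exI[of _ "{}"]) simp
next
  case False
  then obtain k :: nat where k: "k * 2 ^ k \<le> n" "n < (k + 1) * 2 ^ (k + 1)" "2 ^ k \<le> n"
    using obtain_halving_depth[of n] by auto
  let ?G = "trie_digraph k n"
  let ?C = "fibers arc_color (arcs ?G)"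
  have "edge_colored_digraph ?G ?C"
    by (simp add: edge_colored_digraph_def digraph_trie_digraph partition_on_fibers)
  moreover have "1 * real n \<le> real (card (verts ?G))"
    using card_verts_trie_digraph(1) by simp
  moreover have "real (card (verts ?G)) \<le> 3 * real n"
  proof -
    have "card (verts ?G) \<le> (k + 1) * 2 ^ k + n" by (rule card_verts_trie_digraph)
    \<comment> \<open>Each of \<open>k * 2 ^ k\<close>, \<open>2 ^ k\<close> and the number of outer
      vertices is at most n.\<close>
    also have "\<dots> \<le> 3 * n" using k by simp
    finally show ?thesis by linarith
  qed
  moreover have "1 / 8 * (real n ^ 2 / ln (real n)) \<le> real (card (arcs H))"
    if H: "color_ft_preserver 1 ?G ?C H" for H
  \<comment> \<open>For n = 1 the logarithm is 0, and division by 0 yields 0, so the bound is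
    trivial.\<close>
  proof (cases "n = 1")
    case True
    then show ?thesis by simp
  next
    case False
    then have "1 / 8 * (real n ^ 2 / ln (real n)) \<le> real (2 ^ k * n)"
      using \<open>n \<noteq> 0\<close> k by (intro halving_depth_bound) auto
    also have "\<dots> \<le> real (card (arcs H))"
      using card_preserver_trie_digraph[OF H] by (simp only: of_nat_le_iff)
    finally show ?thesis .
  qed
  ultimately show ?thesis by blast
qed

theorem theoremB5:
  shows "\<exists>a b c :: real. a > 0 \<and> b > 0 \<and> c > 0 \<and>
    (\<forall>n :: nat. \<exists>(G :: (nat, nat \<times> nat) pre_digraph) C.
       edge_colored_digraph G C \<and>
       a * real n \<le> real (card (verts G)) \<and> real (card (verts G)) \<le> b * real n \<and>
       (\<forall>H. color_ft_preserver 1 G C H \<longrightarrow>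
          real (card (arcs H)) \<ge> c * (real n ^ 2 / ln (real n))))"
  by (rule exI[of _ 1], rule exI[of _ 3], rule exI[of _ "1 / 8"])
    (use color_ft_preserver_lower_bound in simp)

end
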